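(* Let $\mathcal{M}$ be an oriented matroid of rank $r$ on $n$ elements, and let $X,Y$ be cocircuits of $\mathcal{M}$ with $X\neq -Y$. Then $$d_{\mathcal{M}}(X,Y)\le n-r+1+\sum_{k=2}^{|X^0\setminus Y^0|-1}\left(\left\lfloor\frac{n-r-k}{2}\right\rfloor+1\right)$$ (an empty sum being $0$). In particular, if $r\ge 4$ and $n-r\ge 2$, then $$\operatorname{diam}(G^*(\mathcal{M}))\le n-r+1+\sum_{k=2}^{\min(r-2,\,n-r)}\left(\left\lfloor\frac{n-r-k}{2}\right\rfloor+1\right).$$
   Context: Sign vectors: for a finite set $E$ and $X\in\{+,-,0\}^E$, write $X^+=\{e:X_e=+\}$, $X^-=\{e:X_e=-\}$, $X^0=\{e:X_e=0\}$, $\operatorname{supp}(X)=X^+\cup X^-$, and $-X$ for the componentwise negation. For sign vectors $X,Y$, the separating set is $S(X,Y)=(X^+\cap Y^-)\cup(X^-\cap Y^+)$, and the composition $X\circ Y$ is given by $(X\circ Y)_e=X_e$ if $X_e\neq 0$ and $(X\circ Y)_e=Y_e$ otherwise. An oriented matroid $\mathcal{M}=(E,\mathcal{C}^* )$ is a finite set $E$ together with a set $\mathcal{C}^*\subseteq\{+,-,0\}^E$ of (signed) cocircuits satisfying: (CC0) $\mathbf{0}\notin\mathcal{C}^*$; (CC1) $X\in\mathcal{C}^*\Rightarrow -X\in\mathcal{C}^*$; (CC2) if $X,Y\in\mathcal{C}^*$ and $\operatorname{supp}(X)\subseteq\operatorname{supp}(Y)$ then $X=\pm Y$; (CC3) if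 $X,Y\in\mathcal{C}^*$, $X\neq -Y$ and $e\in S(X,Y)$, then there is $Z\in\mathcal{C}^*$ with $Z^+\subseteq (X^+\cup Y^+)\setminus\{e\}$ and $Z^-\subseteq (X^-\cup Y^-)\setminus\{e\}$. The covectors of $\mathcal{M}$ are $\mathbf{0}$ together with all compositions $X^1\circ\cdots\circ X^k$ ($k\ge 1$) of cocircuits, partially ordered componentwise by $0<+$ and $0<-$ ($+,-$ incomparable). The rank $r$ of $\mathcal{M}$ is the largest $k$ such that there is a chain $\mathbf{0}=V_0<V_1<\cdots<V_k$ of covectors. The cocircuit graph $G^*(\mathcal{M})$ has the cocircuits as vertices, with distinct cocircuits $X,Y$ adjacent iff $|X^0\cap Y^0|\ge r-2$ and $S(X,Y)=\emptyset$. $d_{\mathcal{M}}(X,Y)$ denotes graph distance in $G^*(\mathcal{M})$ and $\operatorname{diam}(G^*(\mathcal{M}))$ its maximum over pairs of cocircuits. *)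

theory Defs
  imports Main "HOL-Library.Extended_Nat"
begin

datatype sign = Pos | Neg | Zero

type_synonym 'a signvec = "'a \<Rightarrow> sign"

definition signvecs :: "'a set \<Rightarrow> 'a signvec set" where
  "signvecs E = {X. \<forall>e. e \<notin> E \<longrightarrow> X e = Zero}"

definition zerov :: "'a signvec" where "zerov = (\<lambda>e. Zero)"

definition negs :: "sign \<Rightarrow> sign" where
  "negs s = (case s of Pos \<Rightarrow> Neg | Neg \<Rightarrow> Pos | Zero \<Rightarrow> Zero)"

definition negv :: "'a signvec \<Rightarrow> 'a signvec" where
  "negv X = (\<lambda>e. negs (X e))"

definition plus_set :: "'a signvec \<Rightarrow> 'a set" where "plus_set X = {e. X e = Pos}"
definition minus_set :: "'a signvec \<Rightarrow> 'a set" where "minus_set X = {e. X e = Neg}"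
definition zero_set :: "'a set \<Rightarrow> 'a signvec \<Rightarrow> 'a set" where
  "zero_set E X = {e\<in>E. X e = Zero}"
definition supp :: "'a signvec \<Rightarrow> 'a set" where "supp X = plus_set X \<union> minus_set X"

definition sep :: "'a signvec \<Rightarrow> 'a signvec \<Rightarrow> 'a set" where
  "sep X Y = (plus_set X \<inter> minus_set Y) \<union> (minus_set X \<inter> plus_set Y)"

definition comp :: "'a signvec \<Rightarrow> 'a signvec \<Rightarrow> 'a signvec" where
  "comp X Y = (\<lambda>e. if X e \<noteq> Zero then X e else Y e)"

text \<open>Oriented matroid given by its set of signed cocircuits (axioms CC0--CC3).\<close>
definition oriented_matroid :: "'a set \<Rightarrow> 'a signvec set \<Rightarrow> bool" where
  "oriented_matroid E C \<longleftrightarrow> finite E \<and> C \<subseteq> signvecs E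
    \<and> zerov \<notin> C
    \<and> (\<forall>X\<in>C. negv X \<in> C)
    \<and> (\<forall>X\<in>C. \<forall>Y\<in>C. supp X \<subseteq> supp Y \<longrightarrow> X = Y \<or> X = negv Y)
    \<and> (\<forall>X\<in>C. \<forall>Y\<in>C. \<forall>e. X \<noteq> negv Y \<and> e \<in> sep X Y \<longrightarrow>
         (\<exists>Z\<in>C. plus_set Z \<subseteq> (plus_set X \<union> plus_set Y) - {e}
                \<and> minus_set Z \<subseteq> (minus_set X \<union> minus_set Y) - {e}))"

definition covectors :: "'a signvec set \<Rightarrow> 'a signvec set" where
  "covectors C = insert zerov {foldr comp Xs zerov | Xs. Xs \<noteq> [] \<and> set Xs \<subseteq> C}"

definition sv_le :: "'a signvec \<Rightarrow> 'a signvec \<Rightarrow> bool" where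
  "sv_le X Y \<longleftrightarrow> (\<forall>e. X e = Zero \<or> X e = Y e)"

definition sv_less :: "'a signvec \<Rightarrow> 'a signvec \<Rightarrow> bool" where
  "sv_less X Y \<longleftrightarrow> sv_le X Y \<and> X \<noteq> Y"

definition om_rank :: "'a signvec set \<Rightarrow> nat" where
  "om_rank C = Max {k. \<exists>V :: nat \<Rightarrow> 'a signvec. V 0 = zerov
       \<and> (\<forall>i\<le>k. V i \<in> covectors C) \<and> (\<forall>i<k. sv_less (V i) (V (Suc i)))}"

definition cc_adj :: "'a set \<Rightarrow> 'a signvec set \<Rightarrow> 'a signvec \<Rightarrow> 'a signvec \<Rightarrow> bool" where
  "cc_adj E C X Y \<longleftrightarrow> X \<in> C \<and> Y \<in> C \<and> X \<noteq> Y
     \<and> int (card (zero_set E X \<inter> zero_set E Y)) \<ge> int (om_rank C) - 2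
     \<and> sep X Y = {}"

text \<open>Graph distance (infinity if no path).\<close>
definition cc_dist :: "'a set \<Rightarrow> 'a signvec set \<Rightarrow> 'a signvec \<Rightarrow> 'a signvec \<Rightarrow> enat" where
  "cc_dist E C X Y = Inf {enat k | k. \<exists>p :: nat \<Rightarrow> 'a signvec. p 0 = X \<and> p k = Y
       \<and> (\<forall>i<k. cc_adj E C (p i) (p (Suc i)))}"

definition cc_diam :: "'a set \<Rightarrow> 'a signvec set \<Rightarrow> enat" where
  "cc_diam E C = Sup {cc_dist E C X Y | X Y. X \<in> C \<and> Y \<in> C}"

end

theory Submission
  imports Defs
begin

text \<open>
  Let \<open>H\<close> and \<open>K\<close> be the zero sets of \<open>X\<close> and \<open>Y\<close>, and let \<open>j\<close> be the corank of \<open>H \<inter> K\<close> in \<open>H\<close>.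
  Eliminating separating elements one at a time shows that two non-antipodal cocircuits on a common
  coline have distance at most \<open>card (sep X Z) + 1\<close>. If \<open>j \<ge> 3\<close>, choose a coline \<open>L\<close> with
  \<open>H \<inter> K \<subseteq> L \<subseteq> H\<close> and walk along the circle of \<open>L\<close> from \<open>X\<close>, in both directions, to the first
  cocircuit that vanishes at some element of \<open>K - H\<close>. The two walks cross disjoint sets of elements
  outside \<open>H \<union> K\<close>, so the shorter one has length at most \<open>(n - r - (j - 1)) div 2 + 1\<close>, and it lowers
  the corank. For \<open>j = 2\<close> the cocircuits \<open>X\<close> and \<open>Y\<close> are opposite corners of a convex quadrilateral in a
  rank 3 contraction. Every other element crosses its boundary at most twice, so one of the two
  boundary paths from \<open>X\<close> to \<open>Y\<close> has length at most \<open>n - r + 1\<close>. Working with the corank instead of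
  \<open>card (H - K)\<close> makes the argument independent of uniformity.
\<close>

section \<open>Arithmetic of signs, and pointwise descriptions of supports and separation\<close>

lemma negs_simps [simp]:
  "negs Zero = Zero" "negs Pos = Neg" "negs Neg = Pos"
  by (simp_all add: negs_def)

lemma negs_eq_Zero [simp]: "negs s = Zero \<longleftrightarrow> s = Zero" "Zero = negs s \<longleftrightarrow> s = Zero"
  by (cases s; simp)+

lemma negs_negs [simp]: "negs (negs s) = s"
  by (cases s) auto

lemma eq_negs_iff: "s \<noteq> Zero \<Longrightarrow> t \<noteq> Zero \<Longrightarrow> s = negs t \<longleftrightarrow> s \<noteq> t"
  by (cases s; cases t) auto

lemma negv_apply [simp]: "negv X e = negs (X e)"
  by (simp add: negv_def)

lemma negv_negv [simp]: "negv (negv X) = X"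
  by (rule ext) simp

lemma mem_sep_iff: "e \<in> sep X Y \<longleftrightarrow> X e \<noteq> Zero \<and> Y e = negs (X e)"
  by (cases "X e"; cases "Y e") (auto simp: sep_def plus_set_def minus_set_def)

lemma sep_commute: "sep X Y = sep Y X"
  by (auto simp: sep_def)

lemma mem_zero_set [simp]: "e \<in> zero_set E X \<longleftrightarrow> e \<in> E \<and> X e = Zero"
  by (simp add: zero_set_def)

lemma mem_supp_iff: "e \<in> supp X \<longleftrightarrow> X e \<noteq> Zero"
  by (cases "X e") (auto simp: supp_def plus_set_def minus_set_def)

lemma foldr_comp_eq_Zero_iff:
  "foldr comp Xs zerov e = Zero \<longleftrightarrow> (\<forall>X\<in>set Xs. X e = Zero)"
  by (induction Xs) (auto simp: comp_def zerov_def)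

section \<open>The cocircuit axioms read pointwise, and elimination without signs\<close>

locale om =
  fixes E :: "'a set" and C :: "'a signvec set"
  assumes om: "oriented_matroid E C"
begin

lemma finite_E: "finite E"
  using om by (simp add: oriented_matroid_def)

lemma outside: "X \<in> C \<Longrightarrow> e \<notin> E \<Longrightarrow> X e = Zero"
  using om by (auto simp: oriented_matroid_def signvecs_def)

lemma in_E: "X \<in> C \<Longrightarrow> X e \<noteq> Zero \<Longrightarrow> e \<in> E"
  using outside by blast

lemma negv_in: "X \<in> C \<Longrightarrow> negv X \<in> C"
  using om by (simp add: oriented_matroid_def)

lemma nonzero: "X \<in> C \<Longrightarrow> \<exists>e. X e \<noteq> Zero"
  using om by (metis (full_types) oriented_matroid_def zerov_def ext)

lemma minimal:
  assumes "X \<in> C" "Y \<in> C" "\<And>e. Y e = Zero \<Longrightarrow> X e = Zero"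
  shows "X = Y \<or> X = negv Y"
proof -
  have "supp X \<subseteq> supp Y" using assms(3) by (auto simp: mem_supp_iff)
  then show ?thesis using om assms(1,2) unfolding oriented_matroid_def by blast
qed

lemma elim:
  assumes "X \<in> C" "Y \<in> C" "X \<noteq> negv Y" "X e \<noteq> Zero" "Y e = negs (X e)"
  obtains Z where "Z \<in> C" "Z e = Zero" "\<And>f. Z f = Zero \<or> Z f = X f \<or> Z f = Y f"
proof -
  have "e \<in> sep X Y" using assms by (simp add: mem_sep_iff)
  then obtain Z where Z: "Z \<in> C" "plus_set Z \<subseteq> (plus_set X \<union> plus_set Y) - {e}"
      "minus_set Z \<subseteq> (minus_set X \<union> minus_set Y) - {e}"
    using om assms(1-3) unfolding oriented_matroid_def by metis
  have "Z e = Zero" using Z(2,3)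
    by (cases "Z e") (auto simp: plus_set_def minus_set_def)
  moreover have "Z f = Zero \<or> Z f = X f \<or> Z f = Y f" for f
    using Z(2,3) by (cases "Z f") (auto simp: plus_set_def minus_set_def)
  ultimately show ?thesis using that Z(1) by blast
qed

text \<open>Negating \<open>Y\<close> if necessary makes the signs at \<open>e\<close> opposite, so
  signed elimination applies; \<open>f\<close> shows that the two cocircuits are not
  antipodal.\<close>

lemma elim_unsigned:
  assumes "X \<in> C" "Y \<in> C" "X e \<noteq> Zero" "Y e \<noteq> Zero" "X f \<noteq> Zero" "Y f = Zero"
  obtains Z where "Z \<in> C" "Z e = Zero" "\<And>g. X g = Zero \<Longrightarrow> Y g = Zero \<Longrightarrow> Z g = Zero"
proof -
  define Y' where "Y' = (if Y e = X e then negv Y else Y)"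
  have Y': "Y' \<in> C" "\<And>g. Y' g = Zero \<longleftrightarrow> Y g = Zero"
    using assms negv_in by (auto simp: Y'_def)
  have "Y' e = negs (X e)"
    using assms eq_negs_iff[of "Y e" "X e"] by (auto simp: Y'_def)
  moreover have "X \<noteq> negv Y'" using assms Y' by (metis negs_eq_Zero negv_apply)
  ultimately obtain Z where "Z \<in> C" "Z e = Zero" "\<And>f. Z f = Zero \<or> Z f = X f \<or> Z f = Y' f"
    using elim[of X Y' e] assms Y'(1) by metis
  then show ?thesis using that Y'(2) by metis
qed

text \<open>The classical derivation of strong from weak elimination in matroids, by induction on
  the size of the union of the two supports.\<close>

lemma strong_elim_unsigned:
  assumes "X \<in> C" "Y \<in> C" "X e \<noteq> Zero" "Y e \<noteq> Zero" "X f \<noteq> Zero" "Y f = Zero"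
  shows "\<exists>Z\<in>C. Z e = Zero \<and> Z f \<noteq> Zero \<and> (\<forall>g. X g = Zero \<longrightarrow> Y g = Zero \<longrightarrow> Z g = Zero)"
  using assms
proof (induction "card {g. X g \<noteq> Zero \<or> Y g \<noteq> Zero}" arbitrary: X Y e f rule: less_induct)
  case less
  let ?U = "\<lambda>X Y. {g. X g \<noteq> Zero \<or> Y g \<noteq> (Zero::sign)}"
  have fin: "finite (?U X Y)"
    using in_E[OF less.prems(1)] in_E[OF less.prems(2)]
    by (intro finite_subset[OF _ finite_E]) auto
  obtain Z1 where Z1: "Z1 \<in> C" "Z1 e = Zero" "\<And>g. X g = Zero \<Longrightarrow> Y g = Zero \<Longrightarrow> Z1 g = Zero"
    using elim_unsigned[OF less.prems] by metis
  show ?case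
  proof (cases "Z1 f = Zero")
    case False
    then show ?thesis using Z1 by blast
  next
    case True
    \<comment> \<open>Weak elimination has lost \<open>f\<close>. Minimality gives \<open>g\<close>
      in the support of \<open>Z1\<close> but not of \<open>X\<close>. Then \<open>g\<close> is
      eliminated between \<open>Y\<close> and \<open>Z1\<close> keeping \<open>e\<close>, and
      \<open>e\<close> between \<open>X\<close> and the result keeping \<open>f\<close>. The first
      union of supports lacks \<open>f\<close>, the second lacks \<open>g\<close>.\<close>
    have "\<not> (Z1 = X \<or> Z1 = negv X)" using Z1(2) less.prems(3) by auto
    then obtain g where g: "X g = Zero" "Z1 g \<noteq> Zero"
      using minimal[OF Z1(1) less.prems(1)] by blast
    then have Yg: "Y g \<noteq> Zero" using Z1(3) by blast
    have "?U Y Z1 \<subset> ?U X Y" using Z1(3) True less.prems(5,6) by blast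
    then have "card (?U Y Z1) < card (?U X Y)" using fin by (rule psubset_card_mono[rotated])
    then obtain Z2 where Z2: "Z2 \<in> C" "Z2 g = Zero" "Z2 e \<noteq> Zero"
        "\<forall>h. Y h = Zero \<longrightarrow> Z1 h = Zero \<longrightarrow> Z2 h = Zero"
      using less.hyps[OF _ less.prems(2) Z1(1) Yg g(2) less.prems(4) Z1(2)] by auto
    have "?U X Z2 \<subset> ?U X Y" using Z1(3) Z2(2,4) g Yg by blast
    then have "card (?U X Z2) < card (?U X Y)" using fin by (rule psubset_card_mono[rotated])
    moreover have "Z2 f = Zero" using Z2(4) True less.prems(6) by blast
    ultimately obtain Z3 where "Z3 \<in> C" "Z3 e = Zero" "Z3 f \<noteq> Zero"
        "\<forall>h. X h = Zero \<longrightarrow> Z2 h = Zero \<longrightarrow> Z3 h = Zero"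
      using less.hyps[OF _ less.prems(1) Z2(1) less.prems(3) Z2(3) less.prems(5)] by auto
    then show ?thesis using Z2(4) Z1(3) by blast
  qed
qed

subsection \<open>The underlying matroid\<close>

text \<open>Independence in the underlying matroid, whose hyperplanes are the zero sets of
  cocircuits: \<open>e\<close> is outside the closure of \<open>A - {e}\<close> iff some hyperplane
  contains \<open>A - {e}\<close> but not \<open>e\<close>.\<close>

definition indep :: "'a set \<Rightarrow> bool" where
  "indep A \<longleftrightarrow> (\<forall>e\<in>A. \<exists>X\<in>C. X e \<noteq> Zero \<and> (\<forall>g\<in>A - {e}. X g = Zero))"

lemma indep_subset_E: "indep A \<Longrightarrow> A \<subseteq> E"
  unfolding indep_def using in_E by blast

lemma indep_finite: "indep A \<Longrightarrow> finite A"
  using indep_subset_E finite_E finite_subset by blast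

lemma indep_empty: "indep {}"
  by (simp add: indep_def)

lemma indep_mono: "indep A \<Longrightarrow> B \<subseteq> A \<Longrightarrow> indep B"
  unfolding indep_def by (meson Diff_mono in_mono order_refl)

text \<open>A witness for an old element \<open>e\<close> may be nonzero at \<open>f\<close>. Strong
  elimination against \<open>X\<close>, which vanishes at \<open>e\<close>, removes \<open>f\<close>
  and keeps \<open>e\<close>.\<close>

lemma indep_insert:
  assumes "indep A" "X \<in> C" "X f \<noteq> Zero" "\<And>g. g \<in> A \<Longrightarrow> X g = Zero"
  shows "indep (insert f A)"
  unfolding indep_def
proof
  fix e assume e: "e \<in> insert f A"
  show "\<exists>Z\<in>C. Z e \<noteq> Zero \<and> (\<forall>g\<in>insert f A - {e}. Z g = Zero)"
  proof (cases "e = f")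
    case True
    then show ?thesis using assms(2-4) by auto
  next
    case False
    then have "e \<in> A" using e by simp
    then obtain Y where Y: "Y \<in> C" "Y e \<noteq> Zero" "\<forall>g\<in>A - {e}. Y g = Zero"
      using assms(1) by (auto simp: indep_def)
    show ?thesis
    proof (cases "Y f = Zero")
      case True
      then show ?thesis using Y by auto
    next
      case False
      obtain Z where Z: "Z \<in> C" "Z f = Zero" "Z e \<noteq> Zero"
          "\<forall>g. Y g = Zero \<longrightarrow> X g = Zero \<longrightarrow> Z g = Zero"
        using strong_elim_unsigned[OF Y(1) assms(2) False assms(3) Y(2)] assms(4)[OF \<open>e \<in> A\<close>] by blast
      have "\<forall>g\<in>insert f A - {e}. Z g = Zero" using Z(2,4) Y(3) assms(4) by auto
      then show ?thesis using Z(1,3) by blast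
    qed
  qed
qed

text \<open>The last hypothesis says that \<open>B\<close> lies in the closure of \<open>A\<close>.
  An element \<open>a\<close> of \<open>A - B\<close> is either dropped as redundant or exchanged
  for an element of \<open>B\<close>.\<close>

lemma steinitz:
  assumes "finite A" "indep B" "\<And>X. X \<in> C \<Longrightarrow> \<forall>a\<in>A. X a = Zero \<Longrightarrow> \<forall>b\<in>B. X b = Zero"
  shows "card B \<le> card A"
  using assms
proof (induction "card (A - B)" arbitrary: A rule: less_induct)
  case less
  show ?case
  proof (cases "A \<subseteq> B")
    case True
    have "B \<subseteq> A"
    proof
      fix b assume b: "b \<in> B"
      then obtain X where "X \<in> C" "X b \<noteq> Zero" "\<forall>g\<in>B - {b}. X g = Zero"
        using \<open>indep B\<close> by (auto simp: indep_def)
      then show "b \<in> A" using less.prems(3)[of X] b True by (metis Diff_iff in_mono singletonD)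
    qed
    then show ?thesis using True by simp
  next
    case False
    then obtain a where a: "a \<in> A" "a \<notin> B" by blast
    show ?thesis
    proof (cases "\<forall>X\<in>C. (\<forall>g\<in>A - {a}. X g = Zero) \<longrightarrow> (\<forall>b\<in>B. X b = Zero)")
      case True
      have "card (A - {a} - B) < card (A - B)"
        using a less.prems(1) by (intro psubset_card_mono) auto
      then have "card B \<le> card (A - {a})"
        using less.hyps[of "A - {a}"] less.prems(1,2) True by blast
      then show ?thesis using less.prems(1) card_Diff1_le[of A a] by linarith
    next
      case False
      then obtain X b where X: "X \<in> C" "\<forall>g\<in>A - {a}. X g = Zero" and b: "b \<in> B" "X b \<noteq> Zero" by blast
      have Xa: "X a \<noteq> Zero" using less.prems(3)[OF X(1)] X(2) b by blast
      have bA: "b \<notin> A" using X(2) a b by blast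
      define A' where "A' = insert b (A - {a})"
      have cA': "card A' = card A" "finite A'"
        using bA a(1) less.prems(1) card_Suc_Diff1[of A a] by (auto simp: A'_def)
      have "A' - B \<subset> A - B" using a b by (auto simp: A'_def)
      then have smaller: "card (A' - B) < card (A - B)"
        using less.prems(1) by (intro psubset_card_mono) auto
      \<comment> \<open>If \<open>Y\<close> were nonzero at \<open>a\<close>, eliminating
        \<open>a\<close> against \<open>X\<close> while keeping \<open>b\<close> would give a
        cocircuit that vanishes on \<open>A\<close> but not at \<open>b\<close>.\<close>
      have spans: "\<forall>b\<in>B. Y b = Zero" if Y: "Y \<in> C" "\<forall>g\<in>A'. Y g = Zero" for Y
      proof (cases "Y a = Zero")
        case True
        then show ?thesis using less.prems(3)[OF Y(1)] Y(2) by (auto simp: A'_def)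
      next
        case False
        have "Y b = Zero" using Y(2) by (simp add: A'_def)
        then obtain Z where Z: "Z \<in> C" "Z a = Zero" "Z b \<noteq> Zero"
            "\<forall>g. X g = Zero \<longrightarrow> Y g = Zero \<longrightarrow> Z g = Zero"
          using strong_elim_unsigned[OF X(1) Y(1) Xa False b(2)] by blast
        have "\<forall>g\<in>A. Z g = Zero" using Z(2,4) X(2) Y(2) by (auto simp: A'_def)
        then show ?thesis using less.prems(3)[OF Z(1)] Z(3) b(1) by blast
      qed
      show ?thesis using less.hyps[OF smaller cA'(2) less.prems(2) spans] cA'(1) by simp
    qed
  qed
qed

lemma augment:
  assumes "indep A" "indep B" "card A < card B"
  obtains b where "b \<in> B" "b \<notin> A" "indep (insert b A)"
proof -
  obtain X b where X: "X \<in> C" "\<forall>a\<in>A. X a = Zero" and b: "b \<in> B" "X b \<noteq> Zero"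
    using steinitz[OF indep_finite[OF assms(1)] assms(2)] assms(3) by (meson leD)
  have "indep (insert b A)" using indep_insert[OF assms(1) X(1) b(2)] X(2) by blast
  then show ?thesis using that b X(2) by blast
qed

section \<open>Rank: chains of covectors against independent sets\<close>

text \<open>From the top of the chain downwards, each step contributes an element \<open>e i\<close>
  where \<open>V i\<close> vanishes and \<open>V (Suc i)\<close> does not. Some cocircuit composing
  \<open>V (Suc i)\<close> is nonzero there, and it vanishes on all elements collected so
  far.\<close>

lemma chain_imp_indep:
  assumes "\<forall>i\<le>k. V i \<in> covectors C" "\<forall>i<k. sv_less (V i) (V (Suc i))"
  shows "\<exists>A. indep A \<and> card A = k"
proof -
  have "\<exists>e. V i e = Zero \<and> V (Suc i) e \<noteq> Zero" if "i < k" for i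
    using assms(2) that unfolding sv_less_def sv_le_def by (metis ext)
  then obtain e where e: "\<And>i. i < k \<Longrightarrow> V i (e i) = Zero \<and> V (Suc i) (e i) \<noteq> Zero"
    by metis
  have le: "V i f = Zero" if "i \<le> j" "j \<le> k" "V j f = Zero" for i j f
    using that
  proof (induction j rule: nat_induct)
    case (Suc j)
    show ?case
    proof (cases "i \<le> j")
      case True
      have "sv_less (V j) (V (Suc j))" using assms(2) Suc.prems(2) by simp
      then have "V j f = Zero" using Suc.prems(3) unfolding sv_less_def sv_le_def by metis
      then show ?thesis using Suc True by simp
    next
      case False
      then have "i = Suc j" using Suc by simp
      then show ?thesis using Suc by simp
    qed
  qed simp
  have "\<exists>A. indep A \<and> card A = j \<and> (\<forall>a\<in>A. V (k - j) a = Zero)" if "j \<le> k" for j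
    using that
  proof (induction j)
    case 0
    then show ?case using indep_empty by (intro exI[of _ "{}"]) simp
  next
    case (Suc j)
    then obtain A where A: "indep A" "card A = j" "\<forall>a\<in>A. V (k - j) a = Zero" by auto
    define i where "i = k - Suc j"
    have i: "i < k" "Suc i = k - j" using Suc by (auto simp: i_def)
    have V: "V (k - j) \<in> covectors C" "V (k - j) (e i) \<noteq> Zero"
      using assms(1) e[OF i(1)] i(2) by auto
    then obtain Xs where Xs: "V (k - j) = foldr comp Xs zerov" "set Xs \<subseteq> C"
      by (auto simp: covectors_def zerov_def)
    then obtain X where X: "X \<in> set Xs" "X (e i) \<noteq> Zero"
      using V(2) foldr_comp_eq_Zero_iff by metis
    have "X \<in> C" using X Xs by auto
    moreover have "X g = Zero" if "g \<in> A" for g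
      using A(3) that Xs(1) X(1) foldr_comp_eq_Zero_iff by metis
    ultimately have "indep (insert (e i) A)" using indep_insert[OF A(1)] X(2) by blast
    moreover have "e i \<notin> A" using A(3) V(2) by blast
    moreover have "\<forall>a\<in>insert (e i) A. V i a = Zero"
      using e[OF i(1)] A(3) le[of i "k - j"] i by auto
    ultimately show ?case using A indep_finite[OF A(1)] i_def
      by (intro exI[of _ "insert (e i) A"]) simp
  qed
  from this[of k] show ?thesis by auto
qed

text \<open>The witnesses of independence are composed one after another; each is the first to be
  nonzero at its own element, so the chain is strict.\<close>

lemma indep_imp_chain:
  assumes "indep A" "card A = k"
  shows "\<exists>V :: nat \<Rightarrow> 'a signvec. V 0 = zerov \<and> (\<forall>i\<le>k. V i \<in> covectors C) \<and>
           (\<forall>i<k. sv_less (V i) (V (Suc i)))"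
proof -
  obtain es where es: "set es = A" "distinct es" "length es = k"
    using finite_distinct_list[OF indep_finite[OF assms(1)]] assms(2) distinct_card by metis
  obtain X where X: "\<And>e. e \<in> A \<Longrightarrow> X e \<in> C \<and> X e e \<noteq> Zero \<and> (\<forall>g\<in>A - {e}. X e g = Zero)"
    using assms(1) unfolding indep_def by metis
  define V where "V i = foldr comp (map X (take i es)) zerov" for i
  have VZ: "V i g = Zero \<longleftrightarrow> (\<forall>e\<in>set (take i es). X e g = Zero)" for i g
    unfolding V_def foldr_comp_eq_Zero_iff by simp
  have app: "foldr comp (xs @ [x]) zerov = comp (foldr comp xs zerov) x" for xs and x :: "'a signvec"
    by (induction xs) (auto simp: comp_def zerov_def fun_eq_iff)
  have "V i \<in> covectors C" for i
  proof (cases "take i es = []")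
    case True
    then show ?thesis unfolding V_def covectors_def by (simp only: list.map foldr.simps id_apply insertI1)
  next
    case False
    moreover have "set (map X (take i es)) \<subseteq> C" using X es(1) set_take_subset[of i es] by auto
    ultimately show ?thesis unfolding V_def covectors_def
      by (intro insertI2 CollectI exI[of _ "map X (take i es)"]) simp
  qed
  moreover have "sv_less (V i) (V (Suc i))" if i: "i < k" for i
  proof -
    have tk: "take (Suc i) es = take i es @ [es ! i]" using i es(3) by (simp add: take_Suc_conv_app_nth)
    have VS: "V (Suc i) = comp (V i) (X (es ! i))" unfolding V_def tk by (simp add: app del: foldr_append)
    have "es ! i \<notin> set (take i es)" using es(2,3) i tk
      by (metis distinct_take distinct_append not_distinct_conv_prefix)
    then have "V i (es ! i) = Zero" using X es(1) i es(3) set_take_subset[of i es]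
      unfolding VZ by (metis Diff_iff in_mono nth_mem singletonD)
    moreover have "X (es ! i) (es ! i) \<noteq> Zero" using X es(1,3) i by (metis nth_mem)
    ultimately have "V (Suc i) (es ! i) \<noteq> V i (es ! i)" by (simp add: VS comp_def)
    then have "V i \<noteq> V (Suc i)" by metis
    moreover have "sv_le (V i) (V (Suc i))" unfolding sv_le_def VS by (auto simp: comp_def)
    ultimately show ?thesis by (simp add: sv_less_def)
  qed
  moreover have "V 0 = zerov" by (simp add: V_def)
  ultimately show ?thesis by blast
qed

abbreviation r :: nat where "r \<equiv> om_rank C"
abbreviation n :: nat where "n \<equiv> card E"

lemma om_rank_eq: "r = Max {card A | A. indep A}"
proof -
  have "{k. \<exists>V :: nat \<Rightarrow> 'a signvec. V 0 = zerov
       \<and> (\<forall>i\<le>k. V i \<in> covectors C) \<and> (\<forall>i<k. sv_less (V i) (V (Suc i)))} = {card A | A. indep A}"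
    (is "?S = ?T")
  proof (intro subset_antisym subsetI)
    fix k assume "k \<in> ?S"
    then show "k \<in> ?T" using chain_imp_indep by blast
  next
    fix k assume "k \<in> ?T"
    then show "k \<in> ?S" using indep_imp_chain by blast
  qed
  then show ?thesis unfolding om_rank_def by simp
qed

lemma finite_indep_cards: "finite {card A | A. indep A}"
proof -
  have "{card A | A. indep A} \<subseteq> card ` Pow E" using indep_subset_E by auto
  then show ?thesis using finite_E finite_subset by blast
qed

lemma card_indep_le: "indep A \<Longrightarrow> card A \<le> r"
  unfolding om_rank_eq by (rule Max_ge[OF finite_indep_cards]) blast

lemma ex_basis: "\<exists>B. indep B \<and> card B = r"
proof -
  have "r \<in> {card A | A. indep A}"
    unfolding om_rank_eq using finite_indep_cards indep_empty by (intro Max_in) auto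
  then show ?thesis by auto
qed

lemma ex_cocircuit:
  assumes "indep A" "card A < r"
  obtains Z where "Z \<in> C" "\<And>a. a \<in> A \<Longrightarrow> Z a = Zero"
proof -
  obtain b where b: "b \<notin> A" "indep (insert b A)"
    using augment[OF assms(1)] ex_basis assms(2) by metis
  then obtain Z where "Z \<in> C" "\<forall>g\<in>insert b A - {b}. Z g = Zero"
    unfolding indep_def by blast
  then show ?thesis using that b(1) by blast
qed

section \<open>Hyperplanes, their bases, and elimination on a coline\<close>

lemma extend_indep:
  assumes "indep A" "A \<subseteq> S"
  obtains B where "A \<subseteq> B" "B \<subseteq> S" "indep B" "\<And>e. e \<in> S \<Longrightarrow> indep (insert e B) \<Longrightarrow> e \<in> B"
proof -
  define P where "P B \<longleftrightarrow> A \<subseteq> B \<and> B \<subseteq> S \<and> indep B" for B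
  have "P A" using assms by (simp add: P_def)
  moreover have "\<forall>B. P B \<longrightarrow> card B \<le> r" using card_indep_le by (simp add: P_def)
  ultimately obtain B where B: "P B" "\<And>B'. P B' \<Longrightarrow> card B' \<le> card B"
    using ex_has_greatest_nat[of P A card "Suc r"] by (meson le_imp_less_Suc)
  have "e \<in> B" if "e \<in> S" "indep (insert e B)" for e
  proof (rule ccontr)
    assume "e \<notin> B"
    moreover have "P (insert e B)" using that B(1) by (auto simp: P_def)
    ultimately show False using B(2)[of "insert e B"] B(1) indep_finite by (simp add: P_def)
  qed
  then show ?thesis using that B(1) by (auto simp: P_def)
qed

text \<open>If \<open>B\<close> were smaller, some cocircuit \<open>Z\<close> would vanish on
  \<open>B\<close> and at an element \<open>e\<close> outside the hyperplane. Maximality of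
  \<open>B\<close> makes \<open>Z\<close> vanish on the whole hyperplane, against minimality of
  supports.\<close>

lemma card_maximal_in_hyperplane:
  assumes X: "X \<in> C" and B: "B \<subseteq> zero_set E X" "indep B"
    and max: "\<And>e. e \<in> zero_set E X \<Longrightarrow> indep (insert e B) \<Longrightarrow> e \<in> B"
  shows "card B + 1 = r"
proof -
  obtain e where e: "X e \<noteq> Zero" using nonzero[OF X] by blast
  have BX: "\<And>g. g \<in> B \<Longrightarrow> X g = Zero" using B(1) by auto
  then have iB: "indep (insert e B)" using indep_insert[OF B(2) X e] by blast
  have "e \<notin> B" using BX e by blast
  then have card_insert: "card (insert e B) = card B + 1" using indep_finite[OF B(2)] by simp
  then have "card B + 1 \<le> r" using card_indep_le[OF iB] by simp
  moreover have False if lt: "card B + 1 < r"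
  proof -
    obtain Z where Z: "Z \<in> C" "\<And>a. a \<in> insert e B \<Longrightarrow> Z a = Zero"
      using ex_cocircuit[OF iB] lt unfolding card_insert by blast
    have "Z g = Zero" if "X g = Zero" for g
    proof (rule ccontr)
      assume g: "Z g \<noteq> Zero"
      then have "indep (insert g B)" using indep_insert[OF B(2) Z(1) g] Z(2) by blast
      moreover have "g \<in> zero_set E X" using in_E[OF Z(1) g] that by simp
      ultimately show False using max Z(2) g by blast
    qed
    then show False using minimal[OF Z(1) X] Z(2) e by (metis insertI1 negs_eq_Zero negv_apply)
  qed
  ultimately show ?thesis by fastforce
qed

lemma extend_to_hyperplane_basis:
  assumes "X \<in> C" "indep A" "A \<subseteq> zero_set E X"
  obtains B where "A \<subseteq> B" "B \<subseteq> zero_set E X" "indep B" "card B + 1 = r"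
proof -
  obtain B where B: "A \<subseteq> B" "B \<subseteq> zero_set E X" "indep B"
      "\<And>e. e \<in> zero_set E X \<Longrightarrow> indep (insert e B) \<Longrightarrow> e \<in> B"
    using extend_indep[OF assms(2,3)] by blast
  then show ?thesis using that card_maximal_in_hyperplane[OF assms(1)] by blast
qed

lemma card_indep_in_hyperplane:
  assumes "X \<in> C" "indep A" "A \<subseteq> zero_set E X"
  shows "card A + 1 \<le> r"
proof -
  obtain B where B: "A \<subseteq> B" "B \<subseteq> zero_set E X" "indep B" "card B + 1 = r"
    by (rule extend_to_hyperplane_basis[OF assms])
  have "card A \<le> card B" using indep_finite[OF B(3)] B(1) by (rule card_mono)
  then show ?thesis using B(4) by simp
qed

lemma card_zero_set_ge:
  assumes "X \<in> C"
  shows "r \<le> card (zero_set E X) + 1"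
proof -
  obtain B where B: "{} \<subseteq> B" "B \<subseteq> zero_set E X" "indep B" "card B + 1 = r"
    by (rule extend_to_hyperplane_basis[OF assms indep_empty empty_subsetI])
  have "finite (zero_set E X)" using finite_E by (simp add: zero_set_def)
  then have "card B \<le> card (zero_set E X)" using B(2) by (rule card_mono)
  then show ?thesis using B(4) by simp
qed

text \<open>A zero of \<open>X\<close> at which \<open>Z\<close> is nonzero would extend
  \<open>A\<close> to \<open>r\<close> independent elements inside the hyperplane of
  \<open>X\<close>. Later arguments identify cocircuits up to sign this way.\<close>

lemma unique_cocircuit:
  assumes X: "X \<in> C" and Z: "Z \<in> C" and A: "indep A" "card A + 1 = r"
    and XA: "\<And>a. a \<in> A \<Longrightarrow> X a = Zero" and ZA: "\<And>a. a \<in> A \<Longrightarrow> Z a = Zero"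
  shows "Z = X \<or> Z = negv X"
proof (rule minimal[OF Z X])
  fix g assume g: "X g = Zero"
  show "Z g = Zero"
  proof (rule ccontr)
    assume Zg: "Z g \<noteq> Zero"
    then have "indep (insert g A)" using indep_insert[OF A(1) Z Zg] ZA by blast
    moreover have "insert g A \<subseteq> zero_set E X"
      using g XA in_E[OF Z Zg] indep_subset_E[OF A(1)] by auto
    ultimately have "card (insert g A) + 1 \<le> r" using card_indep_in_hyperplane X by blast
    moreover have "g \<notin> A" using ZA Zg by blast
    ultimately show False using A(2) indep_finite[OF A(1)] by simp
  qed
qed

text \<open>Two cocircuits on a coline that share a zero outside the closure of \<open>L\<close>
  agree up to sign. Since \<open>Z\<close> vanishes at \<open>e\<close> and \<open>U\<close>,
  \<open>V\<close> do not, \<open>Z\<close> shares no such zero with either, which fixes its sign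
  wherever one of them vanishes.\<close>

lemma modular_elim:
  assumes L: "indep L" "card L + 2 = r" and U: "U \<in> C" and V: "V \<in> C"
    and UL: "\<And>a. a \<in> L \<Longrightarrow> U a = Zero" and VL: "\<And>a. a \<in> L \<Longrightarrow> V a = Zero"
    and e: "U e \<noteq> Zero" "V e = negs (U e)" and ne: "U \<noteq> negv V"
  shows "\<exists>Z\<in>C. Z e = Zero \<and> (\<forall>a\<in>L. Z a = Zero) \<and>
    (\<forall>f. (Z f = Zero \<or> Z f = U f \<or> Z f = V f) \<and>
         (V f = Zero \<longrightarrow> Z f = U f) \<and> (U f = Zero \<longrightarrow> Z f = V f))"
proof -
  obtain Z where Z: "Z \<in> C" "Z e = Zero" "\<And>f. Z f = Zero \<or> Z f = U f \<or> Z f = V f"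
    using elim[OF U V ne e] by blast
  have ZL: "Z a = Zero" if "a \<in> L" for a
    using Z(3)[of a] UL[OF that] VL[OF that] by auto
  have key: "Z f \<noteq> Zero"
    if W: "W \<in> C" "\<And>a. a \<in> L \<Longrightarrow> W a = Zero" "W f = Zero" "W e \<noteq> Zero"
      and W': "W' \<in> C" "\<And>a. a \<in> L \<Longrightarrow> W' a = Zero" "W' f \<noteq> Zero" for W W' f
  proof
    assume Zf: "Z f = Zero"
    have "indep (insert f L)" using indep_insert[OF L(1) W'(1,3)] W'(2) by blast
    moreover have "f \<notin> L" using W'(2,3) by blast
    then have "card (insert f L) + 1 = r" using L indep_finite by simp
    ultimately have "Z = W \<or> Z = negv W"
      using unique_cocircuit[OF W(1) Z(1), of "insert f L"] W(2,3) ZL Zf by blast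
    then show False using W(4) Z(2) by auto
  qed
  have "Z f = U f" if "V f = Zero" for f
  proof (cases "U f = Zero")
    case True
    then show ?thesis using Z(3)[of f] that by auto
  next
    case False
    then have "Z f \<noteq> Zero" using key[OF V VL that _ U UL] e by simp
    then show ?thesis using Z(3)[of f] that by auto
  qed
  moreover have "Z f = V f" if "U f = Zero" for f
  proof (cases "V f = Zero")
    case True
    then show ?thesis using Z(3)[of f] that by auto
  next
    case False
    then have "Z f \<noteq> Zero" using key[OF U UL that e(1) V VL] by simp
    then show ?thesis using Z(3)[of f] that by auto
  qed
  ultimately show ?thesis using Z ZL by blast
qed

subsection \<open>Distances\<close>

text \<open>The integer bound avoids truncated subtraction; relation powers make concatenating and
  reversing paths easy.\<close>

definition dist_le :: "int \<Rightarrow> 'a signvec \<Rightarrow> 'a signvec \<Rightarrow> bool" where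
  "dist_le b X Y \<longleftrightarrow> (\<exists>k. int k \<le> b \<and> (X, Y) \<in> {(X, Y). cc_adj E C X Y} ^^ k)"

lemma dist_le_refl: "0 \<le> b \<Longrightarrow> dist_le b X X"
  unfolding dist_le_def by (intro exI[of _ 0]) simp

lemma dist_le_mono: "dist_le b X Y \<Longrightarrow> b \<le> b' \<Longrightarrow> dist_le b' X Y"
  unfolding dist_le_def by (meson order_trans)

lemma dist_le_trans:
  assumes "dist_le b X Y" "dist_le b' Y Z"
  shows "dist_le (b + b') X Z"
proof -
  obtain k k' where "int k \<le> b" "int k' \<le> b'"
    "(X, Y) \<in> {(X, Y). cc_adj E C X Y} ^^ k" "(Y, Z) \<in> {(X, Y). cc_adj E C X Y} ^^ k'"
    using assms unfolding dist_le_def by blast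
  then show ?thesis unfolding dist_le_def by (intro exI[of _ "k + k'"]) (auto simp: relpow_add)
qed

lemma dist_le_sym:
  assumes "dist_le b X Y"
  shows "dist_le b Y X"
proof -
  let ?R = "{(X, Y). cc_adj E C X Y}"
  have "?R\<inverse> = ?R" by (auto simp: cc_adj_def sep_commute Int_commute)
  moreover have "(R ^^ k)\<inverse> = R\<inverse> ^^ k" for R :: "'a signvec rel" and k
    by (induction k) (simp_all add: converse_relcomp relpow_commute)
  ultimately have "(?R ^^ k)\<inverse> = ?R ^^ k" for k by simp
  then show ?thesis using assms unfolding dist_le_def by blast
qed

lemma dist_le_imp_cc_dist:
  assumes "dist_le b X Y"
  shows "\<exists>d. cc_dist E C X Y = enat d \<and> int d \<le> b"
proof -
  obtain k where k: "int k \<le> b" "(X, Y) \<in> {(X, Y). cc_adj E C X Y} ^^ k"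
    using assms unfolding dist_le_def by blast
  have "cc_dist E C X Y \<le> enat k"
    unfolding cc_dist_def using k(2) by (intro Inf_lower) (auto simp: relpow_fun_conv)
  then show ?thesis using k(1) by (cases "cc_dist E C X Y") auto
qed

lemma card_le_of_vanishing:
  assumes "A \<subseteq> zero_set E X \<inter> zero_set E Y"
  shows "card A \<le> card (zero_set E X \<inter> zero_set E Y)"
  using assms finite_E by (intro card_mono) (auto intro: finite_subset[OF _ finite_E])

lemma sep_subset_E: "X \<in> C \<Longrightarrow> sep X Y \<subseteq> E"
  using in_E by (auto simp: mem_sep_iff)

text \<open>Eliminating a separating element \<open>e\<close> gives \<open>Z\<close> that keeps all
  common zeros, with \<open>sep X Z\<close> and \<open>sep Z Y\<close> disjoint inside
  \<open>sep X Y - {e}\<close>. The loss of \<open>e\<close> pays for the extra 1 of the second half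
  of the path.\<close>

lemma dist_le_sep:
  assumes "X \<in> C" "Y \<in> C" "X \<noteq> negv Y" "r \<le> card (zero_set E X \<inter> zero_set E Y) + 2"
  shows "dist_le (int (card (sep X Y)) + 1) X Y"
  using assms
proof (induction "card (sep X Y)" arbitrary: X Y rule: less_induct)
  case less
  have fin: "finite (sep X' Y')" if "X' \<in> C" for X' Y'
    using sep_subset_E[OF that] finite_E finite_subset by blast
  show ?case
  proof (cases "sep X Y = {}")
    case True
    show ?thesis
    proof (cases "X = Y")
      case True
      then show ?thesis by (simp add: dist_le_refl)
    next
      case False
      then have "cc_adj E C X Y" using less.prems True by (simp add: cc_adj_def)
      then show ?thesis unfolding dist_le_def by (intro exI[of _ 1]) simp
    qed
  next
    case False
    then obtain e where e: "X e \<noteq> Zero" "Y e = negs (X e)" by (auto simp: mem_sep_iff)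
    obtain Z where Z: "Z \<in> C" "Z e = Zero" "\<And>f. Z f = Zero \<or> Z f = X f \<or> Z f = Y f"
      using elim[OF less.prems(1-3) e] by metis
    have neg_neq: "negs s \<noteq> s" if "s \<noteq> Zero" for s using that by (cases s) auto
    have sub: "sep X Z \<subseteq> sep X Y - {e}" "sep Z Y \<subseteq> sep X Y - {e}"
      using Z(2,3) neg_neq by (auto simp: mem_sep_iff) (metis negs_negs negs_eq_Zero)+
    have disj: "sep X Z \<inter> sep Z Y = {}"
      using Z(3) neg_neq by (auto simp: mem_sep_iff) (metis negs_negs negs_eq_Zero)
    have eS: "e \<in> sep X Y" using e by (simp add: mem_sep_iff)
    have "card (sep X Z) + card (sep Z Y) = card (sep X Z \<union> sep Z Y)"
      using disj fin[OF less.prems(1)] fin[OF Z(1)] by (simp add: card_Un_disjoint)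
    also have "\<dots> \<le> card (sep X Y - {e})"
      using sub fin[OF less.prems(1)] by (intro card_mono) auto
    finally have le: "card (sep X Z) + card (sep Z Y) + 1 \<le> card (sep X Y)"
      using eS fin[OF less.prems(1)] by (metis add_le_mono1 card_Suc_Diff1 Suc_eq_plus1)
    have "zero_set E X \<inter> zero_set E Y \<subseteq> zero_set E X \<inter> zero_set E Z"
         "zero_set E X \<inter> zero_set E Y \<subseteq> zero_set E Z \<inter> zero_set E Y"
      using Z(3) by auto metis+
    then have "r \<le> card (zero_set E X \<inter> zero_set E Z) + 2" "r \<le> card (zero_set E Z \<inter> zero_set E Y) + 2"
      using card_le_of_vanishing less.prems(4) by (meson add_le_mono1 le_trans)+
    moreover have "X \<noteq> negv Z" "Z \<noteq> negv Y" using Z(2) e by auto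
    ultimately have "dist_le (int (card (sep X Z)) + 1) X Z" "dist_le (int (card (sep Z Y)) + 1) Z Y"
      using less.hyps[of X Z] less.hyps[of Z Y] less.prems(1,2) Z(1) le by auto
    then show ?thesis using dist_le_trans dist_le_mono le by (smt (verit) of_nat_1 of_nat_add of_nat_le_iff)
  qed
qed

section \<open>Quadrilaterals in a rank 3 contraction\<close>

text \<open>All three cocircuits lie on the coline spanned by \<open>insert a I\<close>. Eliminating
  \<open>b\<close> between \<open>U\<close> and \<open>negv V\<close> gives \<open>X\<close> up to
  sign, with the sign of \<open>U\<close> at \<open>d\<close> and of \<open>negv V\<close> at
  \<open>c\<close>.\<close>

lemma opposite_on_coline:
  assumes I: "indep (insert a (insert b I))" "card I + 3 = r" "a \<noteq> b" "a \<notin> I" "b \<notin> I"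
    and X: "X \<in> C" "\<And>g. g \<in> I \<Longrightarrow> X g = Zero" "X a = Zero" "X b = Zero" "X c \<noteq> Zero" "X d \<noteq> Zero"
    and U: "U \<in> C" "\<And>g. g \<in> I \<Longrightarrow> U g = Zero" "U a = Zero" "U c = Zero" "U d \<noteq> Zero"
    and V: "V \<in> C" "\<And>g. g \<in> I \<Longrightarrow> V g = Zero" "V a = Zero" "V d = Zero"
    and UV: "U b \<noteq> Zero" "V b = U b"
  shows "U d = X d \<longleftrightarrow> V c = negs (X c)"
proof -
  have fI: "finite I" using indep_finite[OF I(1)] by simp
  have L: "indep (insert a I)" "card (insert a I) + 2 = r"
    using indep_mono[OF I(1)] I fI by auto
  have ne: "U \<noteq> negv (negv V)" and eq: "negv V b = negs (U b)" using U(5) V(4) UV(2) by auto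
  have UV0: "U g = Zero" "negv V g = Zero" if "g \<in> insert a I" for g
    using that U V by auto
  obtain W where W: "W \<in> C" "W b = Zero" "\<And>g. g \<in> insert a I \<Longrightarrow> W g = Zero"
      "\<And>f. negv V f = Zero \<Longrightarrow> W f = U f" "\<And>f. U f = Zero \<Longrightarrow> W f = negv V f"
    using modular_elim[OF L U(1) negv_in[OF V(1)] UV0 UV(1) eq ne] by metis
  have "card (insert a (insert b I)) + 1 = r" using I fI by simp
  moreover have "W g = Zero" "X g = Zero" if "g \<in> insert a (insert b I)" for g
    using that W(2,3) X(2-4) by auto
  ultimately have "W = X \<or> W = negv X" using unique_cocircuit[OF X(1) W(1) I(1)] by blast
  moreover have "W d = U d" "W c = negs (V c)" using W(4)[of d] W(5)[of c] V U by auto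
  ultimately show ?thesis using X(5,6)
    by (cases "X c"; cases "X d"; cases "V c") auto
qed

text \<open>The four flats spanned by \<open>I\<close> and one of \<open>a, b, c, d\<close> bound a quadrilateral with corners
  \<open>X\<close>, \<open>P\<close>, \<open>Y\<close>, \<open>Q\<close> in the rank 3 contraction by \<open>I\<close>. An element separating neighbouring corners
  on all four sides would cross the boundary of this convex region four times.\<close>

lemma no_alternation:
  assumes iab: "indep (insert a (insert b I))" and icd: "indep (insert c (insert d I))"
    and I: "card I + 3 = r" and dist: "a \<noteq> b" "c \<noteq> d" "a \<notin> I" "b \<notin> I" "c \<notin> I" "d \<notin> I"
    and X: "X \<in> C" "\<And>g. g \<in> I \<Longrightarrow> X g = Zero" "X a = Zero" "X b = Zero" "X c \<noteq> Zero" "X d \<noteq> Zero"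
    and Y: "Y \<in> C" "\<And>g. g \<in> I \<Longrightarrow> Y g = Zero" "Y c = Zero" "Y d = Zero" "Y a \<noteq> Zero" "Y b \<noteq> Zero"
    and P: "P \<in> C" "\<And>g. g \<in> I \<Longrightarrow> P g = Zero" "P a = Zero" "P c = Zero" "P b = Y b" "P d = X d"
    and Q: "Q \<in> C" "\<And>g. g \<in> I \<Longrightarrow> Q g = Zero" "Q b = Zero" "Q d = Zero" "Q a = Y a" "Q c = X c"
    and g: "X g \<noteq> Zero" "Y g = X g" "P g = negs (X g)" "Q g = negs (X g)"
  shows False
proof -
  have fI: "finite I" using indep_finite[OF iab] by simp
  have d: "indep (insert d I)" "card (insert d I) + 2 = r"
    using indep_mono[OF icd] I fI dist by auto
  have a: "indep (insert a I)" "card (insert a I) + 2 = r"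
    using indep_mono[OF iab] I fI dist by auto
  have neQ: "Y \<noteq> negv (negv Q)" and eqQ: "negv Q a = negs (Y a)" using Q(3,5) Y(6) by auto
  have YQ0: "Y g = Zero" "negv Q g = Zero" if "g \<in> insert d I" for g
    using that Y Q by auto
  \<comment> \<open>At \<open>c\<close>, where \<open>Y\<close> vanishes, \<open>W\<close> follows
    \<open>negv Q\<close> and is opposite to \<open>X\<close>; at \<open>g\<close> both sources have
    the sign of \<open>X\<close>.\<close>
  obtain W where W: "W \<in> C" "W a = Zero" "\<And>h. h \<in> insert d I \<Longrightarrow> W h = Zero"
      "\<And>f. W f = Zero \<or> W f = Y f \<or> W f = negv Q f"
      "\<And>f. negv Q f = Zero \<Longrightarrow> W f = Y f" "\<And>f. Y f = Zero \<Longrightarrow> W f = negv Q f"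
    using modular_elim[OF d Y(1) negv_in[OF Q(1)] YQ0 Y(5) eqQ neQ] by metis
  have Wb: "W b = Y b" and Wc: "W c = negs (X c)" and Wg: "W g = Zero \<or> W g = X g"
    using W(5)[of b] W(6)[of c] W(4)[of g] Q Y g by auto
  have neb: "W b \<noteq> Zero" "W c \<noteq> Zero" using Wb Wc X(5) Y(6) by simp_all
  then have neP: "W \<noteq> negv (negv P)" and eqP: "negv P b = negs (W b)"
    using Wb P(4,5) by auto
  have WP0: "W g = Zero" "negv P g = Zero" if "g \<in> insert a I" for g
    using that W(2,3) P by auto
  \<comment> \<open>\<open>W'\<close> vanishes on \<open>I\<close>, \<open>a\<close> and
    \<open>b\<close>, so it is \<open>X\<close> up to sign. Its sign at \<open>c\<close> forces
    \<open>negv X\<close>, which its sign at \<open>g\<close> excludes.\<close>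
  obtain W' where W': "W' \<in> C" "W' b = Zero" "\<And>h. h \<in> insert a I \<Longrightarrow> W' h = Zero"
      "\<And>f. W' f = Zero \<or> W' f = W f \<or> W' f = negv P f"
      "\<And>f. negv P f = Zero \<Longrightarrow> W' f = W f"
    using modular_elim[OF a W(1) negv_in[OF P(1)] WP0 neb(1) eqP neP] by metis
  have "card (insert a (insert b I)) + 1 = r" using I dist fI by simp
  moreover have "W' h = Zero" "X h = Zero" if "h \<in> insert a (insert b I)" for h
    using that W'(2,3) X(2-4) by auto
  ultimately have "W' = X \<or> W' = negv X" using unique_cocircuit[OF X(1) W'(1) iab] by blast
  moreover have "W' c = negs (X c)" using W'(5)[of c] P(4) Wc by simp
  moreover have "W' g = Zero \<or> W' g = X g" using W'(4)[of g] Wg g(3) by auto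
  ultimately show False using X(5) g(1) by (cases "X c"; cases "X g") auto
qed

text \<open>The \<open>r + 1\<close> elements of \<open>J\<close> separate no neighbouring corners
  and every other element at most two pairs, so both boundary paths together have at most
  \<open>2 * (n - r - 1)\<close> crossings. Each path costs 2 more, and the shorter one
  fits.\<close>

lemma dist_le_convex_quadrilateral:
  assumes iab: "indep (insert a (insert b I))" and icd: "indep (insert c (insert d I))"
    and I: "card I + 3 = r" and dist: "a \<noteq> b" "c \<noteq> d" "a \<notin> I" "b \<notin> I" "c \<notin> I" "d \<notin> I"
    and X: "X \<in> C" "\<And>g. g \<in> I \<Longrightarrow> X g = Zero" "X a = Zero" "X b = Zero" "X c \<noteq> Zero" "X d \<noteq> Zero"
    and Y: "Y \<in> C" "\<And>g. g \<in> I \<Longrightarrow> Y g = Zero" "Y c = Zero" "Y d = Zero" "Y a \<noteq> Zero" "Y b \<noteq> Zero"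
    and P: "P \<in> C" "\<And>g. g \<in> I \<Longrightarrow> P g = Zero" "P a = Zero" "P c = Zero" "P b = Y b" "P d = X d"
    and Q: "Q \<in> C" "\<And>g. g \<in> I \<Longrightarrow> Q g = Zero" "Q b = Zero" "Q d = Zero" "Q a = Y a" "Q c = X c"
  shows "dist_le (int n - int r + 1) X Y"
proof -
  have fI: "finite I" using indep_finite[OF iab] by simp
  have sE: "insert a (insert b I) \<subseteq> E" "insert c (insert d I) \<subseteq> E"
    using indep_subset_E iab icd by auto
  define J where "J = insert a (insert b (insert c (insert d I)))"
  have "a \<noteq> c" "a \<noteq> d" "b \<noteq> c" "b \<noteq> d" using X Y by auto
  then have J: "J \<subseteq> E" "card J = card I + 4"
    using sE fI dist by (auto simp: J_def)
  have split: "card (sep U V) = (\<Sum>g\<in>E. of_bool (g \<in> sep U V))" if "U \<in> C" for U V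
    using sep_subset_E[OF that, of V] finite_E by (simp add: sum.If_cases of_bool_def Int_absorb1)
  define t :: "'a \<Rightarrow> nat" where "t g = of_bool (g \<in> sep X P) + of_bool (g \<in> sep P Y)
      + of_bool (g \<in> sep Y Q) + of_bool (g \<in> sep Q X)" for g
  \<comment> \<open>Around a cycle of four signs exactly three opposite neighbouring pairs cannot
    occur, so only four must be excluded.\<close>
  have "t g \<le> (if g \<in> J then 0 else 2)" for g
  proof (cases "g \<in> J")
    case True
    then show ?thesis using X(2-4) Y(2-4) P(2-6) Q(2-6)
      by (auto simp: J_def t_def mem_sep_iff) (metis sign.distinct negs_simps sign.exhaust)+
  next
    case False
    have "\<not> (X g \<noteq> Zero \<and> Y g = X g \<and> P g = negs (X g) \<and> Q g = negs (X g))"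
      using no_alternation[OF assms] by blast
    then show ?thesis using False unfolding t_def mem_sep_iff
      by (cases "X g"; cases "Y g"; cases "P g"; cases "Q g") auto
  qed
  then have "(\<Sum>g\<in>E. t g) \<le> (\<Sum>g\<in>E. if g \<in> J then 0 else 2)" by (intro sum_mono)
  also have "\<dots> = 2 * card (E - J)" using finite_E
    by (simp add: sum.If_cases Diff_eq)
  also have "card (E - J) = n - card J" using J finite_E by (simp add: card_Diff_subset finite_subset)
  finally have "card (sep X P) + card (sep P Y) + card (sep Y Q) + card (sep Q X) \<le> 2 * (n - card J)"
    using split X(1) P(1) Y(1) Q(1) by (simp add: t_def sum.distrib)
  moreover have "card J \<le> n" using J finite_E card_mono by blast
  ultimately have total: "int (card (sep X P)) + int (card (sep P Y)) + (int (card (sep Y Q)) + int (card (sep Q X)))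
      \<le> 2 * (int n - int r - 1)" using J(2) I by arith
  have side: "dist_le (int (card (sep U V)) + 1) U V"
    if "U \<in> C" "V \<in> C" "U \<noteq> negv V" "h \<notin> I" "h \<in> E" "U h = Zero" "V h = Zero"
      "\<And>g. g \<in> I \<Longrightarrow> U g = Zero" "\<And>g. g \<in> I \<Longrightarrow> V g = Zero" for U V h
  proof (rule dist_le_sep[OF that(1-3)])
    have "insert h I \<subseteq> zero_set E U \<inter> zero_set E V" using that sE by auto
    from card_le_of_vanishing[OF this] show "r \<le> card (zero_set E U \<inter> zero_set E V) + 2"
      using that(4) fI I by simp
  qed
  have neq: "s \<noteq> negs s" if "s \<noteq> Zero" for s using that by (cases s) auto
  have "X \<noteq> negv P" "P \<noteq> negv Y" "Y \<noteq> negv Q" "Q \<noteq> negv X"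
    using neq X(5,6) Y(5,6) P(5,6) Q(5,6) by (metis negv_apply)+
  then have "dist_le (int (card (sep X P)) + 1) X P" "dist_le (int (card (sep P Y)) + 1) P Y"
    "dist_le (int (card (sep Y Q)) + 1) Y Q" "dist_le (int (card (sep Q X)) + 1) Q X"
    using side[of X P a] side[of P Y c] side[of Y Q d] side[of Q X b] X Y P Q sE dist by auto
  then have "dist_le (int (card (sep X P)) + 1 + (int (card (sep P Y)) + 1)) X Y"
    "dist_le (int (card (sep Y Q)) + 1 + (int (card (sep Q X)) + 1)) X Y"
    using dist_le_trans dist_le_sym by blast+
  then show ?thesis using total dist_le_mono
    by (smt (verit))
qed

text \<open>The corner vanishes on the colines of \<open>insert a I\<close> and
  \<open>insert c I\<close>. A zero at \<open>b\<close> or \<open>d\<close> would make it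
  \<open>X\<close> or \<open>Y\<close> up to sign; so its sign can be chosen to match
  \<open>Y\<close> at \<open>b\<close>.\<close>

lemma ex_corner:
  assumes iab: "indep (insert a (insert b I))" and icd: "indep (insert c (insert d I))"
    and I: "card I + 3 = r" and dist: "a \<noteq> b" "c \<noteq> d" "a \<notin> I" "b \<notin> I" "c \<notin> I" "d \<notin> I"
    and X: "X \<in> C" "\<And>g. g \<in> I \<Longrightarrow> X g = Zero" "X a = Zero" "X b = Zero" "X c \<noteq> Zero" "X d \<noteq> Zero"
    and Y: "Y \<in> C" "\<And>g. g \<in> I \<Longrightarrow> Y g = Zero" "Y c = Zero" "Y d = Zero" "Y a \<noteq> Zero" "Y b \<noteq> Zero"
  obtains P where "P \<in> C" "\<And>g. g \<in> I \<Longrightarrow> P g = Zero" "P a = Zero" "P c = Zero" "P b = Y b" "P d \<noteq> Zero"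
proof -
  have fI: "finite I" using indep_finite[OF iab] by simp
  have "indep (insert a I)" using indep_mono[OF iab] by auto
  then have "indep (insert c (insert a I))" using indep_insert[OF _ X(1,5)] X(2,3) by auto
  moreover have "card (insert c (insert a I)) < r" using fI I card_insert_le_m1
    by (simp add: card_insert_if)
  ultimately obtain P where P: "P \<in> C" "\<And>g. g \<in> insert c (insert a I) \<Longrightarrow> P g = Zero"
    using ex_cocircuit by metis
  have Pb: "P b \<noteq> Zero"
  proof
    assume "P b = Zero"
    moreover have "card (insert a (insert b I)) + 1 = r" using I dist fI by simp
    ultimately have "P = X \<or> P = negv X"
      using unique_cocircuit[OF X(1) P(1) iab] P(2) X(2-4) by auto
    then show False using P(2)[of c] X(5) by auto
  qed
  have Pd: "P d \<noteq> Zero"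
  proof
    assume "P d = Zero"
    moreover have "card (insert c (insert d I)) + 1 = r" using I dist fI by simp
    ultimately have "P = Y \<or> P = negv Y"
      using unique_cocircuit[OF Y(1) P(1) icd] P(2) Y(2-4) by auto
    then show False using P(2)[of a] Y(5) by auto
  qed
  show ?thesis
  proof (cases "P b = Y b")
    case True
    then show ?thesis using that[of P] P Pd by auto
  next
    case False
    then have "negv P b = Y b" using Pb Y(6) eq_negs_iff[of "Y b" "P b"] by auto
    then show ?thesis using that[of "negv P"] negv_in P Pd by auto
  qed
qed

text \<open>All four possible corners are signed to agree with \<open>Y\<close>. The relations
  between their signs show that \<open>P\<close>, \<open>Q\<close> or else \<open>R\<close>,
  \<open>S\<close> also match \<open>X\<close>; swapping \<open>c\<close> and \<open>d\<close> turns
  one case into the other.\<close>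

lemma dist_le_quadrilateral:
  assumes iab: "indep (insert a (insert b I))" and icd: "indep (insert c (insert d I))"
    and I: "card I + 3 = r" and dist: "a \<noteq> b" "c \<noteq> d" "a \<notin> I" "b \<notin> I" "c \<notin> I" "d \<notin> I"
    and X: "X \<in> C" "\<And>g. g \<in> I \<Longrightarrow> X g = Zero" "X a = Zero" "X b = Zero" "X c \<noteq> Zero" "X d \<noteq> Zero"
    and Y: "Y \<in> C" "\<And>g. g \<in> I \<Longrightarrow> Y g = Zero" "Y c = Zero" "Y d = Zero" "Y a \<noteq> Zero" "Y b \<noteq> Zero"
  shows "dist_le (int n - int r + 1) X Y"
proof -
  have iba: "indep (insert b (insert a I))" and idc: "indep (insert d (insert c I))"
    using iab icd by (simp_all add: insert_commute)
  note neq = dist(1)[symmetric] dist(2)[symmetric]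
  obtain P where P: "P \<in> C" "\<And>g. g \<in> I \<Longrightarrow> P g = Zero" "P a = Zero" "P c = Zero" "P b = Y b" "P d \<noteq> Zero"
    using ex_corner[OF assms] by blast
  obtain R where R: "R \<in> C" "\<And>g. g \<in> I \<Longrightarrow> R g = Zero" "R a = Zero" "R d = Zero" "R b = Y b" "R c \<noteq> Zero"
    using ex_corner[OF iab idc I dist(1) neq(2) dist(3,4,6,5) X(1-4) X(6,5) Y(1,2) Y(4,3,5,6)] by blast
  obtain Q where Q: "Q \<in> C" "\<And>g. g \<in> I \<Longrightarrow> Q g = Zero" "Q b = Zero" "Q d = Zero" "Q a = Y a" "Q c \<noteq> Zero"
    using ex_corner[OF iba idc I neq dist(4,3,6,5) X(1,2) X(4,3) X(6,5) Y(1,2) Y(4,3) Y(6,5)] by blast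
  obtain S where S: "S \<in> C" "\<And>g. g \<in> I \<Longrightarrow> S g = Zero" "S b = Zero" "S c = Zero" "S a = Y a" "S d \<noteq> Zero"
    using ex_corner[OF iba icd I neq(1) dist(2,4,3,5,6) X(1,2) X(4,3) X(5,6) Y(1,2) Y(3,4) Y(6,5)] by blast
  have 1: "P d = X d \<longleftrightarrow> R c = negs (X c)"
    using opposite_on_coline[OF iab I dist(1,3,4) X P(1-4,6) R(1-4)] P(5) R(5) Y(6) by simp
  \<comment> \<open>If the signs at \<open>d\<close> agreed, the coline of \<open>c\<close>, with
    \<open>Y\<close> in the role of \<open>X\<close>, would make \<open>S a\<close> opposite to
    \<open>Y a\<close>.\<close>
  have 2: "P d \<noteq> S d"
    using opposite_on_coline[OF icd I dist(2,5,6) Y P(1,2,4,3) _ S(1,2,4,3)] P(5,6) S(5) Y(5,6)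
      eq_negs_iff[of "Y a" "Y a"] by auto
  have 3: "R c \<noteq> Q c"
    using opposite_on_coline[OF idc I neq(2) dist(6,5) Y(1,2,4,3,5,6) R(1,2,4,3) _ Q(1,2,4,3)]
      R(5,6) Q(5) Y(5,6) eq_negs_iff[of "Y a" "Y a"] by auto
  show ?thesis
  proof (cases "P d = X d")
    case True
    then have "R c = negs (X c)" using 1 by simp
    then have "Q c = X c" using 3 Q(6) X(5) eq_negs_iff[of "Q c" "X c"] by auto
    then show ?thesis using dist_le_convex_quadrilateral[OF assms P(1-5) True Q(1-5)] by blast
  next
    case False
    then have "R c = X c" using 1 R(6) X(5) eq_negs_iff[of "R c" "X c"] by auto
    moreover have "S d = X d" using False 2 P(6) S(6) X(6) by (cases "P d"; cases "S d"; cases "X d") auto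
    ultimately show ?thesis
      using dist_le_convex_quadrilateral[OF iab idc I dist(1) neq(2) dist(3,4,6,5) X(1-4) X(6,5)
          Y(1,2) Y(4,3,5,6) R(1-5) _ S(1-5)] by blast
  qed
qed

section \<open>Bases relative to the common zeros, and walks along a coline\<close>

lemma complete_to_hyperplane_basis:
  assumes X: "X \<in> C" and I: "indep I" "I \<subseteq> zero_set E X \<inter> zero_set E Y"
    and max: "\<And>e. e \<in> zero_set E X \<inter> zero_set E Y \<Longrightarrow> indep (insert e I) \<Longrightarrow> e \<in> I"
    and j: "card I + 1 + j = r"
  obtains A where "indep (I \<union> A)" "A \<inter> I = {}" "A \<subseteq> zero_set E X - zero_set E Y" "finite A" "card A = j"
proof -
  obtain B where B: "I \<subseteq> B" "B \<subseteq> zero_set E X" "indep B" "card B + 1 = r"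
    using extend_to_hyperplane_basis[OF X I(1)] I(2) by auto
  have fB: "finite B" using indep_finite[OF B(3)] .
  define A where "A = B - I"
  have "I \<union> A = B" using B(1) by (auto simp: A_def)
  then have "indep (I \<union> A)" using B(3) by simp
  moreover have "A \<subseteq> zero_set E X - zero_set E Y"
  proof
    fix e assume e: "e \<in> A"
    then have "indep (insert e I)" using indep_mono[OF B(3)] B(1) by (auto simp: A_def)
    then show "e \<in> zero_set E X - zero_set E Y" using max[of e] e B(2) by (auto simp: A_def)
  qed
  moreover have "card A = j"
    using card_Diff_subset[OF indep_finite[OF I(1)] B(1)] B(4) j by (simp add: A_def)
  moreover have "A \<inter> I = {}" by (auto simp: A_def)
  moreover have "finite A" using fB by (simp add: A_def)
  ultimately show ?thesis using that by blast
qed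

text \<open>\<open>Z\<close> and \<open>W\<close> in the proof are the first suitable cocircuits in the two directions: \<open>W\<close> is sought
  between \<open>X\<close> and \<open>negv Z\<close>, so that \<open>sep X W\<close> avoids \<open>sep X Z\<close>.\<close>

lemma ex_near_cocircuit:
  assumes X: "X \<in> C" and Y: "Y \<in> C" and L: "indep L" "card L + 2 = r" "L \<subseteq> zero_set E X"
    and j: "0 < j" "j \<le> card (zero_set E Y - zero_set E X)"
  obtains Z f where "Z \<in> C" "f \<in> E" "Y f = Zero" "X f \<noteq> Zero" "Z f = Zero" "\<forall>g\<in>L. Z g = Zero"
    "2 * int (card (sep X Z)) \<le> int n - int r + 1 - int j"
proof -
  define cand where "cand W \<longleftrightarrow> W \<in> C \<and> (\<forall>g\<in>L. W g = Zero) \<and>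
      (\<exists>f\<in>E. Y f = Zero \<and> X f \<noteq> Zero \<and> W f = Zero)" for W
  have XL: "\<And>g. g \<in> L \<Longrightarrow> X g = Zero" using L(3) by auto
  have fin: "finite (sep X W)" for W using sep_subset_E[OF X] finite_E finite_subset by blast
  \<comment> \<open>A candidate with fewest separating elements is chosen. A separating zero
    \<open>g\<close> of \<open>Y\<close> could be eliminated, giving a nearer candidate that
    vanishes at \<open>g\<close>.\<close>
  have near: "\<exists>W. cand W \<and> sep X W \<subseteq> sep X W0 \<and> (\<forall>g\<in>sep X W. Y g \<noteq> Zero)" if "cand W0" for W0
  proof -
    define P where "P W \<longleftrightarrow> cand W \<and> sep X W \<subseteq> sep X W0" for W
    have "P W0" using that by (simp add: P_def)
    then obtain W where W: "P W" "\<And>W'. P W' \<Longrightarrow> card (sep X W) \<le> card (sep X W')"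
      using ex_has_least_nat[of P W0 "\<lambda>W. card (sep X W)"] by blast
    have "Y g \<noteq> Zero" if g: "g \<in> sep X W" for g
    proof
      assume Yg: "Y g = Zero"
      have e: "X g \<noteq> Zero" "W g = negs (X g)" using g by (simp_all add: mem_sep_iff)
      obtain f where f: "X f \<noteq> Zero" "W f = Zero" and W': "W \<in> C" "\<forall>g\<in>L. W g = Zero"
        using W(1) by (auto simp: P_def cand_def)
      have "X \<noteq> negv W" using f by auto
      then obtain Z where Z: "Z \<in> C" "Z g = Zero" "\<And>f. Z f = Zero \<or> Z f = X f \<or> Z f = W f"
        using elim[OF X W'(1) _ e] by metis
      have "\<forall>g\<in>L. Z g = Zero" using Z(3) XL W'(2) by metis
      then have "cand Z" using Z(1,2) Yg e(1) in_E[OF X e(1)] by (auto simp: cand_def)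
      moreover have sub: "sep X Z \<subseteq> sep X W - {g}"
      proof
        fix h assume h: "h \<in> sep X Z"
        then have "Z h \<noteq> X h" "Z h \<noteq> Zero" by (cases "X h"; auto simp: mem_sep_iff)+
        then have "Z h = W h" using Z(3)[of h] by simp
        then show "h \<in> sep X W - {g}" using h Z(2) e(1) by (auto simp: mem_sep_iff)
      qed
      moreover have "card (sep X Z) < card (sep X W)"
        using sub g fin by (intro psubset_card_mono) auto
      ultimately show False using W(1) W(2)[of Z] by (auto simp: P_def)
    qed
    then show ?thesis using W(1) by (auto simp: P_def)
  qed
  obtain f where f: "f \<in> E" "Y f = Zero" "X f \<noteq> Zero"
  proof -
    have "zero_set E Y - zero_set E X \<noteq> {}" using j by (metis card.empty leD)
    then obtain f where "f \<in> zero_set E Y - zero_set E X" by blast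
    then show ?thesis using that[of f] by simp
  qed
  have "indep (insert f L)" using indep_insert[OF L(1) X f(3)] XL by blast
  moreover have "card (insert f L) < r" using L(2) indep_finite[OF L(1)] by (simp add: card_insert_if)
  ultimately obtain W0 where "W0 \<in> C" "\<And>g. g \<in> insert f L \<Longrightarrow> W0 g = Zero"
    using ex_cocircuit by metis
  then have "cand W0" using f by (auto simp: cand_def)
  from near[OF this] obtain Z where Z: "cand Z" "\<forall>g\<in>sep X Z. Y g \<noteq> Zero" by blast
  have "cand (negv Z)" using Z(1) negv_in by (auto simp: cand_def)
  from near[OF this] obtain W where W: "cand W" "sep X W \<subseteq> sep X (negv Z)" "\<forall>g\<in>sep X W. Y g \<noteq> Zero"
    by blast
  \<comment> \<open>Neither walk crosses a zero of \<open>X\<close> or of \<open>Y\<close>. These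
    number at least \<open>r - 1 + j\<close>, leaving at most \<open>n - r + 1 - j\<close> elements
    for both walks together.\<close>
  define D where "D = zero_set E X \<union> (zero_set E Y - zero_set E X)"
  have D: "D \<subseteq> E" "card D = card (zero_set E X) + card (zero_set E Y - zero_set E X)"
    using finite_E card_Un_disjoint[of "zero_set E X" "zero_set E Y - zero_set E X"]
    unfolding D_def by (auto simp: zero_set_def)
  have "s \<noteq> negs s" if "s \<noteq> Zero" for s using that by (cases s) auto
  then have "sep X Z \<inter> sep X W = {}" using W(2) by (force simp: mem_sep_iff)
  then have "card (sep X Z) + card (sep X W) = card (sep X Z \<union> sep X W)"
    using fin by (simp add: card_Un_disjoint)
  also have "\<dots> \<le> card (E - D)"
  proof (rule card_mono)
    show "sep X Z \<union> sep X W \<subseteq> E - D"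
      using Z(2) W(3) sep_subset_E[OF X] by (auto simp: D_def mem_sep_iff)
  qed (use finite_E in simp)
  also have "\<dots> = n - card D" using D(1) finite_E by (simp add: card_Diff_subset finite_subset)
  finally have "int (card (sep X Z)) + int (card (sep X W)) \<le> int n - int r + 1 - int j"
    using D(2) card_mono[OF finite_E D(1)] card_zero_set_ge[OF X] j(2) by linarith
  then have "2 * int (card (sep X Z)) \<le> int n - int r + 1 - int j \<or>
      2 * int (card (sep X W)) \<le> int n - int r + 1 - int j" by linarith
  then show ?thesis using that Z(1) W(1) unfolding cand_def by blast
qed

subsection \<open>The distance bound\<close>

text \<open>The argument is one less than a corank: the summand for \<open>k\<close> is the cost of
  a walk that lowers the corank from \<open>k + 1\<close>.\<close>

definition bound :: "int \<Rightarrow> int" where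
  "bound u = int n - int r + 1 + (\<Sum>k\<in>{2..u}. (int n - int r - k) div 2 + 1)"

text \<open>The condition on \<open>v\<close> keeps every added summand positive.\<close>

lemma bound_mono:
  assumes "u \<le> v" "v \<le> int n - int r"
  shows "bound u \<le> bound v"
  unfolding bound_def using assms
  by (intro add_left_mono sum_mono2) auto

lemma bound_small: "u < 2 \<Longrightarrow> bound u = int n - int r + 1"
  by (simp add: bound_def)

lemma bound_step:
  assumes "2 \<le> u"
  shows "bound u = bound (u - 1) + ((int n - int r - u) div 2 + 1)"
proof -
  have "{2..u} = insert u {2..u - 1}" using assms by auto
  then show ?thesis by (simp add: bound_def)
qed

lemma rank_le: "r \<le> n"
  using ex_basis indep_subset_E finite_E card_mono by metis

lemma card_zero_diff_le:
  assumes "X \<in> C"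
  shows "card (zero_set E Y - zero_set E X) + r \<le> n + 1"
proof -
  have "card (zero_set E Y - zero_set E X) \<le> card (E - zero_set E X)"
    using finite_E by (intro card_mono) (auto simp: zero_set_def)
  also have "\<dots> = n - card (zero_set E X)"
    using finite_E by (intro card_Diff_subset) (auto simp: zero_set_def)
  finally show ?thesis using card_zero_set_ge[OF assms] card_mono[OF finite_E, of "zero_set E X"]
    by (auto simp: zero_set_def)
qed

text \<open>Here \<open>j\<close> is the rank of \<open>zero_set E X\<close> minus that of \<open>zero_set E X \<inter> zero_set E Y\<close>.\<close>

lemma dist_le_bound:
  assumes "X \<in> C" "Y \<in> C" "X \<noteq> negv Y" "indep I" "I \<subseteq> zero_set E X \<inter> zero_set E Y"
    and "\<And>e. e \<in> zero_set E X \<inter> zero_set E Y \<Longrightarrow> indep (insert e I) \<Longrightarrow> e \<in> I"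
    and "card I + 1 + j = r"
  shows "dist_le (bound (int j - 1)) X Y"
  using assms
proof (induction j arbitrary: X I rule: less_induct)
  case (less j)
  note X = less.prems(1) and Y = less.prems(2) and I = less.prems(4-7)
  have fI: "finite I" using indep_finite[OF I(1)] .
  obtain A where A: "indep (I \<union> A)" "A \<inter> I = {}" "A \<subseteq> zero_set E X - zero_set E Y" "finite A" "card A = j"
    using complete_to_hyperplane_basis[OF X I] by blast
  obtain B where B: "indep (I \<union> B)" "B \<inter> I = {}" "B \<subseteq> zero_set E Y - zero_set E X" "finite B" "card B = j"
    using complete_to_hyperplane_basis[OF Y I(1), of X j] I(2,3,4) by (auto simp: Int_commute)
  have IX: "\<And>g. g \<in> I \<Longrightarrow> X g = Zero" and IY: "\<And>g. g \<in> I \<Longrightarrow> Y g = Zero" using I(2) by auto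
  have AX: "\<And>a. a \<in> A \<Longrightarrow> X a = Zero \<and> Y a \<noteq> Zero" and BY: "\<And>b. b \<in> B \<Longrightarrow> Y b = Zero \<and> X b \<noteq> Zero"
    using A(3) B(3) by auto
  consider "j = 0" | "j = 1" | "j = 2" | "j \<ge> 3" by linarith
  then show ?case
  proof cases
    case 1
    then have "X = Y \<or> X = negv Y" using unique_cocircuit[OF Y X I(1)] I(4) IX IY by simp
    then have "X = Y" using less.prems(3) by simp
    then show ?thesis using dist_le_refl rank_le 1 by (simp add: bound_small)
  next
    case 2
    obtain a b where ab: "A = {a}" "B = {b}" using A(5) B(5) 2 card_1_singletonE by metis
    have "r \<le> card (zero_set E X \<inter> zero_set E Y) + 2"
      using card_le_of_vanishing[OF I(2)] I(4) 2 by linarith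
    then have d: "dist_le (int (card (sep X Y)) + 1) X Y" using dist_le_sep[OF X Y less.prems(3)] by blast
    have "a \<noteq> b" using AX[of a] BY[of b] ab by auto
    then have J: "card (insert a (insert b I)) = card I + 2" "insert a (insert b I) \<subseteq> E"
      using ab A(2,3) B(2,3) fI indep_subset_E[OF I(1)] by auto
    \<comment> \<open>Since \<open>j = 1\<close>, the removed set has \<open>r\<close> elements, so
      at most \<open>n - r\<close> elements separate.\<close>
    have "sep X Y \<subseteq> E - insert a (insert b I)"
      using sep_subset_E[OF X] AX[of a] BY[of b] ab IX by (auto simp: mem_sep_iff)
    then have "card (sep X Y) \<le> card (E - insert a (insert b I))" using finite_E card_mono by (metis finite_Diff)
    also have "\<dots> = n - (card I + 2)" using J fI by (simp add: card_Diff_subset)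
    finally have "int (card (sep X Y)) + 1 \<le> bound (int j - 1)"
      using 2 I(4) card_mono[OF finite_E J(2)] J(1) by (simp add: bound_small)
    then show ?thesis using d dist_le_mono by blast
  next
    case 3
    obtain a b where ab: "A = {a, b}" "a \<noteq> b" using A(5) 3 card_2_iff by metis
    obtain c d where cd: "B = {c, d}" "c \<noteq> d" using B(5) 3 card_2_iff by metis
    have "dist_le (int n - int r + 1) X Y"
    proof (rule dist_le_quadrilateral[of a b I c d])
      show "indep (insert a (insert b I))" "indep (insert c (insert d I))"
        using A(1) B(1) ab cd by (simp_all add: Un_commute insert_commute)
    qed (use ab cd A(2) B(2) I(4) 3 X Y IX IY AX BY in auto)
    then show ?thesis using 3 by (simp add: bound_small)
  next
    case 4
    obtain a where a: "a \<in> A" using A(5) 4 by fastforce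
    have "card (A - {a}) > 0" using a A(4,5) 4 card_Suc_Diff1[of A a] by linarith
    then have "A - {a} \<noteq> {}" by (metis card.empty less_irrefl)
    \<comment> \<open>This element stays in \<open>L\<close>, so \<open>Z\<close> will vanish there
      while \<open>Y\<close> does not; hence \<open>Z\<close> is not antipodal to
      \<open>Y\<close>.\<close>
    then obtain a' where a': "a' \<in> A - {a}" by blast
    define L where "L = I \<union> (A - {a})"
    have cI: "card (I \<union> A) = card I + j" using A(2,4,5) fI by (simp add: card_Un_disjoint Int_commute)
    have "L = (I \<union> A) - {a}" using a A(2) by (auto simp: L_def)
    then have L: "indep L" "card L + 2 = r" "L \<subseteq> zero_set E X"
      using indep_mono[OF A(1), of L] a cI I(2,4) A(3,4) fI 4 by auto
    have j: "j \<le> card (zero_set E Y - zero_set E X)"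
      using B(3,5) finite_E card_mono[of "zero_set E Y - zero_set E X" B] by (simp add: zero_set_def)
    have "0 < j" using 4 by simp
    then obtain Z f where Z: "Z \<in> C" "Z f = Zero" "\<forall>g\<in>L. Z g = Zero"
        "2 * int (card (sep X Z)) \<le> int n - int r + 1 - int j"
      and f: "f \<in> E" "Y f = Zero" "X f \<noteq> Zero"
      using ex_near_cocircuit[OF X Y L _ j] by metis
    have LZ: "L \<subseteq> zero_set E X \<inter> zero_set E Z" using L(3) Z(3) by auto
    have "X \<noteq> negv Z" using f(3) Z(2) by auto
    then have XZ: "dist_le (int (card (sep X Z)) + 1) X Z"
      using dist_le_sep[OF X Z(1)] card_le_of_vanishing[OF LZ] L(2) by simp
    \<comment> \<open>Passing from \<open>X\<close> to \<open>Z\<close> gains the common zero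
      \<open>f\<close>, independent of \<open>I\<close>, so the new corank \<open>i\<close> is below
      \<open>j\<close>.\<close>
    have iI: "indep (insert f I)" using indep_insert[OF I(1) X f(3)] IX by blast
    have sI: "insert f I \<subseteq> zero_set E Z \<inter> zero_set E Y"
      using f Z(2,3) IY indep_subset_E[OF I(1)] by (auto simp: L_def)
    obtain K where K: "insert f I \<subseteq> K" "K \<subseteq> zero_set E Z \<inter> zero_set E Y" "indep K"
        "\<And>e. e \<in> zero_set E Z \<inter> zero_set E Y \<Longrightarrow> indep (insert e K) \<Longrightarrow> e \<in> K"
      using extend_indep[OF iI sI] by blast
    have "card (insert f I) \<le> card K" using K(1) indep_finite[OF K(3)] card_mono by blast
    moreover have "f \<notin> I" using IX f(3) by blast
    ultimately have cK: "card I + 1 \<le> card K" using fI by simp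
    have "card K + 1 \<le> r" using card_indep_in_hyperplane[OF Z(1) K(3)] K(2) by blast
    then obtain i where i: "card K + 1 + i = r" using le_Suc_ex by metis
    have ij: "i < j" using i cK I(4) by linarith
    have "Z a' = Zero" "Y a' \<noteq> Zero" using Z(3) a' AX by (auto simp: L_def)
    then have "Z \<noteq> negv Y" by auto
    then have "dist_le (bound (int i - 1)) Z Y"
      using less.IH[OF ij Z(1) Y _ K(3,2,4) i] by blast
    moreover have "bound (int i - 1) \<le> bound (int j - 1 - 1)"
      using ij j card_zero_diff_le[OF X, of Y] by (intro bound_mono) linarith+
    ultimately have "dist_le (int (card (sep X Z)) + 1 + bound (int j - 1 - 1)) X Y"
      using dist_le_trans[OF XZ] dist_le_mono by blast
    moreover have "int (card (sep X Z)) + 1 \<le> (int n - int r - (int j - 1)) div 2 + 1"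
      using Z(4) by linarith
    moreover have "bound (int j - 1) = bound (int j - 1 - 1) + ((int n - int r - (int j - 1)) div 2 + 1)"
      using 4 by (intro bound_step) simp
    ultimately show ?thesis by (elim dist_le_mono) linarith
  qed
qed

section \<open>Bounds for pairs, antipodes and the diameter\<close>

text \<open>A maximal independent set of common zeros starts the descent. The bound on
  \<open>j\<close> by \<open>zero_set E X - zero_set E Y\<close> serves single pairs; the other two
  give the minimum in the diameter bound.\<close>

lemma ex_dist_le_bound:
  assumes X: "X \<in> C" and Y: "Y \<in> C" and ne: "X \<noteq> negv Y"
  obtains j where "dist_le (bound (int j - 1)) X Y" "j + 1 \<le> r"
    "j \<le> card (zero_set E X - zero_set E Y)" "int j - 1 \<le> int n - int r"
proof -
  obtain I where I: "I \<subseteq> zero_set E X \<inter> zero_set E Y" "indep I"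
      "\<And>e. e \<in> zero_set E X \<inter> zero_set E Y \<Longrightarrow> indep (insert e I) \<Longrightarrow> e \<in> I"
    using extend_indep[OF indep_empty, of "zero_set E X \<inter> zero_set E Y"] by auto
  have "card I + 1 \<le> r" using card_indep_in_hyperplane[OF X I(2)] I(1) by blast
  then obtain j where j: "card I + 1 + j = r" using le_Suc_ex by metis
  obtain A where A: "A \<subseteq> zero_set E X - zero_set E Y" "card A = j"
    using complete_to_hyperplane_basis[OF X I(2,1,3) j] by blast
  have "j \<le> card (zero_set E X - zero_set E Y)"
    using A finite_E card_mono[of "zero_set E X - zero_set E Y" A] by (simp add: zero_set_def)
  moreover from this have "int j - 1 \<le> int n - int r" using card_zero_diff_le[OF Y, of X] by linarith
  moreover have "j + 1 \<le> r" using j by linarith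
  ultimately show ?thesis using that dist_le_bound[OF X Y ne I(2,1,3) j] by blast
qed

text \<open>The route passes through \<open>Z\<close> on a coline of \<open>X\<close>, vanishing at
  some \<open>f\<close> where \<open>X\<close> does not. No element is crossed on both halves, and
  neither \<open>f\<close> nor a zero of \<open>X\<close> is crossed at all, so there are at most
  \<open>n - r\<close> crossings; the two halves add 2.\<close>

lemma dist_le_antipodal:
  assumes X: "X \<in> C" and r2: "2 \<le> r"
  shows "dist_le (int n - int r + 2) X (negv X)"
proof -
  obtain B where B: "B \<subseteq> zero_set E X" "indep B" "card B + 1 = r"
    using extend_to_hyperplane_basis[OF X indep_empty] by auto
  have "B \<noteq> {}" using B(3) r2 by auto
  then obtain h where h: "h \<in> B" by blast
  define L where "L = B - {h}"
  have L: "indep L" "card L + 2 = r" "\<And>g. g \<in> L \<Longrightarrow> X g = Zero" "L \<subseteq> E"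
    using indep_mono[OF B(2)] B h indep_finite[OF B(2)] card_Suc_Diff1[of B h] by (auto simp: L_def)
  obtain f where f: "X f \<noteq> Zero" using nonzero[OF X] by blast
  have "indep (insert f L)" using indep_insert[OF L(1) X f L(3)] .
  moreover have "card (insert f L) < r" using L(2) indep_finite[OF L(1)] by (simp add: card_insert_if)
  ultimately obtain Z where Z: "Z \<in> C" "\<And>g. g \<in> insert f L \<Longrightarrow> Z g = Zero"
    using ex_cocircuit by metis
  have Zf: "Z f = Zero" using Z(2) by simp
  have nX: "negv X \<in> C" using negv_in[OF X] .
  have ne: "X \<noteq> negv Z" "Z \<noteq> negv (negv X)" using Zf f by auto
  have "L \<subseteq> zero_set E X \<inter> zero_set E Z" "L \<subseteq> zero_set E Z \<inter> zero_set E (negv X)"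
    using L Z(2) by auto
  from this[THEN card_le_of_vanishing] have "dist_le (int (card (sep X Z)) + 1) X Z"
    "dist_le (int (card (sep Z (negv X))) + 1) Z (negv X)"
    using L(2) dist_le_sep[OF X Z(1) ne(1)] dist_le_sep[OF Z(1) nX ne(2)] by auto
  then have d: "dist_le (int (card (sep X Z)) + 1 + (int (card (sep Z (negv X))) + 1)) X (negv X)"
    by (rule dist_le_trans)
  have fin: "finite (sep X Z)" "finite (sep Z (negv X))"
    using sep_subset_E[OF X, of Z] sep_subset_E[OF Z(1), of "negv X"] finite_E finite_subset by blast+
  have "s \<noteq> negs s" if "s \<noteq> Zero" for s using that by (cases s) auto
  then have disj: "sep X Z \<inter> sep Z (negv X) = {}" by (force simp: mem_sep_iff)
  define D where "D = insert f (zero_set E X)"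
  have D: "D \<subseteq> E" "card D = card (zero_set E X) + 1"
    using in_E[OF X f] f finite_E by (auto simp: D_def zero_set_def)
  have "card (sep X Z) + card (sep Z (negv X)) = card (sep X Z \<union> sep Z (negv X))"
    using fin disj by (simp add: card_Un_disjoint)
  also have "\<dots> \<le> card (E - D)"
  proof (rule card_mono)
    show "sep X Z \<union> sep Z (negv X) \<subseteq> E - D"
      using sep_subset_E[OF X, of Z] sep_subset_E[OF Z(1), of "negv X"] Zf
      by (auto simp: D_def mem_sep_iff)
  qed (use finite_E in simp)
  also have "\<dots> = n - card D" using D(1) finite_E by (simp add: card_Diff_subset finite_subset)
  finally have "int (card (sep X Z)) + int (card (sep Z (negv X))) \<le> int n - int r"
    using D(2) card_mono[OF finite_E D(1)] card_zero_set_ge[OF X] by linarith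
  then show ?thesis using d dist_le_mono by (smt (verit))
qed

lemma ex_dist_bound:
  assumes X: "X \<in> C" and Y: "Y \<in> C" and ne: "X \<noteq> negv Y"
  shows "\<exists>d. cc_dist E C X Y = enat d \<and>
    int d \<le> bound (int (card (zero_set E X - zero_set E Y)) - 1)"
proof -
  obtain j where j: "dist_le (bound (int j - 1)) X Y" "j \<le> card (zero_set E X - zero_set E Y)"
    using ex_dist_le_bound[OF assms] by metis
  have "bound (int j - 1) \<le> bound (int (card (zero_set E X - zero_set E Y)) - 1)"
    using j(2) card_zero_diff_le[OF Y, of X] by (intro bound_mono) linarith+
  then show ?thesis using dist_le_imp_cc_dist dist_le_mono j(1) by blast
qed

lemma ex_diam_bound:
  assumes "4 \<le> r" "2 \<le> int n - int r"
  shows "\<exists>d. cc_diam E C = enat d \<and> int d \<le> bound (min (int r - 2) (int n - int r))"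
proof -
  let ?u = "min (int r - 2) (int n - int r)"
  have "dist_le (bound ?u) X Y" if X: "X \<in> C" and Y: "Y \<in> C" for X Y
  proof (cases "X = negv Y")
    case True
    then have "Y = negv X" by simp
    then have "dist_le (int n - int r + 2) X Y" using dist_le_antipodal[OF X] assms(1) by simp
    \<comment> \<open>The summand for \<open>k = 2\<close> is at least 1 because
      \<open>n - r\<close> is at least 2; it absorbs the extra step between antipodes.\<close>
    moreover have "int n - int r + 2 \<le> bound 2"
      using bound_step[of 2] bound_small[of 1] assms(2) by simp
    moreover have "bound 2 \<le> bound ?u" using assms by (intro bound_mono) auto
    ultimately show ?thesis using dist_le_mono by (meson order_trans)
  next
    case False
    obtain j where j: "dist_le (bound (int j - 1)) X Y" "j + 1 \<le> r" "int j - 1 \<le> int n - int r"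
      using ex_dist_le_bound[OF X Y False] by metis
    have "bound (int j - 1) \<le> bound ?u" using j(2,3) by (intro bound_mono) auto
    then show ?thesis using dist_le_mono j(1) by blast
  qed
  then have le: "cc_dist E C X Y \<le> enat (nat (bound ?u))" if "X \<in> C" "Y \<in> C" for X Y
    using dist_le_imp_cc_dist[of "bound ?u" X Y] that by auto
  have "bound 1 \<le> bound ?u" using assms by (intro bound_mono) auto
  then have pos: "0 \<le> bound ?u" using bound_small[of 1] assms(2) by simp
  have "cc_diam E C \<le> enat (nat (bound ?u))"
    unfolding cc_diam_def using le by (intro Sup_least) auto
  then show ?thesis using pos by (cases "cc_diam E C") auto
qed

end

theorem theorem1p8:
  fixes E :: "'a set" and C :: "'a signvec set" and r n :: nat
  assumes "oriented_matroid E C"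
    and "r = om_rank C"
    and "n = card E"
  shows "(\<forall>X\<in>C. \<forall>Y\<in>C. X \<noteq> negv Y \<longrightarrow>
            (\<exists>d. cc_dist E C X Y = enat d \<and>
               int d \<le> int n - int r + 1
                 + (\<Sum>k\<in>{2..int (card (zero_set E X - zero_set E Y)) - 1}.
                      (int n - int r - k) div 2 + 1)))
       \<and> (r \<ge> 4 \<and> int n - int r \<ge> 2 \<longrightarrow>
            (\<exists>d. cc_diam E C = enat d \<and>
               int d \<le> int n - int r + 1
                 + (\<Sum>k\<in>{2..min (int r - 2) (int n - int r)}.
                      (int n - int r - k) div 2 + 1)))"
proof -
  interpret om E C using assms(1) by unfold_locales
  show ?thesis using ex_dist_bound ex_diam_bound unfolding assms(2,3) bound_def by blast
qed

end
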